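(* Let $1/2 < p \le 1$ and let $X(0), X(1), \dots$ be i.i.d. random variables with $P(X(k)=1)=p$ and $P(X(k)=-1)=1-p$. For each integer $n\ge 1$ put $\mathcal{X}_n = \prod_{k=0}^{n-1}(1+X(k)) - 1$ and, for $K\in[0,1]$, $g_n(K) = \frac{1}{n}\mathbb{E}[\log(1+K\mathcal{X}_n)]$. Then for every $n \ge 1$ the optimal Kelly fraction, i.e. the maximizer of $g_n$ over $K\in[0,1]$, is $$K_n^* = \frac{2^n p^n - 1}{2^n-1},$$ and the associated optimal expected logarithmic growth $g_n^* = \max_{K\in[0,1]} g_n(K)$ is $$g_n^* = p^n\log p + \left(\frac{1-p^n}{n}\right)\log\left[\frac{1-p^n}{2^n-1}\right] + \log 2 .$$
   Context: Here $\log$ is the natural logarithm, with $\log 0=-\infty$ (so $g_n$ may take the value $-\infty$) and $0\cdot\log 0 = 0$ (relevant only when $p=1$). An optimal Kelly fraction is any $K_n^*\in[0,1]$ with $g_n(K_n^* ) = g_n^*$. Interpretation: a bettor wagers the fraction $K$ of wealth on an even-money coin flip with probability $p$ of winning and lets the proceeds ride for $n$ flips before updating the bet; $n$ is the number of steps between bet updates and $\mathcal{X}_n$ is the total return over those steps. *)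

theory Defs
  imports "HOL-Probability.Probability"
begin

(* The library has ln 0 = 0 on the reals; here log 0 is minus infinity. Values at negative
   arguments are irrelevant: 1 + K * R is almost surely nonnegative below. *)
definition elog :: "real \<Rightarrow> ereal" where
  "elog x = (if x > 0 then ereal (ln x) else -\<infinity>)"

(* Expectation of an extended-real random variable, E[f] = E[f+] - E[f-]; e2ennreal sends
   negative arguments to 0, so it extracts the positive part. Meaningful whenever one of the
   two parts is finite, as is the positive part in every use below. *)
definition eexpectation :: "'a measure \<Rightarrow> ('a \<Rightarrow> ereal) \<Rightarrow> ereal" where
  "eexpectation M f =
     enn2ereal (\<integral>\<^sup>+ \<omega>. e2ennreal (f \<omega>) \<partial>M) - enn2ereal (\<integral>\<^sup>+ \<omega>. e2ennreal (- f \<omega>) \<partial>M)"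

definition total_return :: "(nat \<Rightarrow> 'a \<Rightarrow> real) \<Rightarrow> nat \<Rightarrow> 'a \<Rightarrow> real" where
  "total_return X n \<omega> = (\<Prod>k<n. 1 + X k \<omega>) - 1"

definition log_growth :: "'a measure \<Rightarrow> (nat \<Rightarrow> 'a \<Rightarrow> real) \<Rightarrow> nat \<Rightarrow> real \<Rightarrow> ereal" where
  "log_growth M X n K =
     ereal (1 / real n) * eexpectation M (\<lambda>\<omega>. elog (1 + K * total_return X n \<omega>))"

(* A supremum, which is attained (so a maximum) exactly when an optimal fraction exists. *)
definition opt_log_growth :: "'a measure \<Rightarrow> (nat \<Rightarrow> 'a \<Rightarrow> real) \<Rightarrow> nat \<Rightarrow> ereal" where
  "opt_log_growth M X n = (SUP K\<in>{0..1}. log_growth M X n K)"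

definition opt_kelly_fraction :: "'a measure \<Rightarrow> (nat \<Rightarrow> 'a \<Rightarrow> real) \<Rightarrow> nat \<Rightarrow> real \<Rightarrow> bool" where
  "opt_kelly_fraction M X n K \<longleftrightarrow> K \<in> {0..1} \<and> log_growth M X n K = opt_log_growth M X n"

end

theory Submission
  imports Defs
begin

text \<open>
  Almost surely every flip is \<open>1\<close> or \<open>-1\<close>, so the total return equals \<open>2 ^ n - 1\<close> when all
  \<open>n\<close> flips win, an event of probability \<open>q = p ^ n\<close>, and \<open>-1\<close> otherwise. Hence
  \<open>n g(K) = q log (1 + K (2 ^ n - 1)) + (1 - q) log (1 - K)\<close>. With \<open>a = (1 + K (2 ^ n - 1)) / 2 ^ n\<close>
  this is \<open>q log a + (1 - q) log (1 - a)\<close> up to a term independent of \<open>K\<close>, and by the Gibbs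
  inequality it is maximal exactly at \<open>a = q\<close>.
\<close>

text \<open>Apply \<open>ln x \<le> x - 1\<close> at \<open>a / q\<close> and at
  \<open>(1 - a) / (1 - q)\<close>: the weighted bounds \<open>a - q\<close> and
  \<open>q - a\<close> cancel, and the first is strict because \<open>a \<noteq> q\<close>. The
  condition \<open>q = 1 \<or> a < 1\<close> excludes the case where \<open>ln 0 = 0\<close> would
  make the left side too large.\<close>

lemma binary_gibbs_strict:
  fixes a q :: real
  assumes "0 < q" "q \<le> 1" "0 < a" "a \<le> 1" "q = 1 \<or> a < 1" "a \<noteq> q"
  shows "q * ln a + (1 - q) * ln (1 - a) < q * ln q + (1 - q) * ln (1 - q)"
proof -
  have "ln (a / q) < a / q - 1"
    using assms ln_le_minus_one[of "a / q"] ln_eq_minus_one[of "a / q"] by fastforce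
  then have "q * (ln a - ln q) < q * (a / q - 1)"
    using assms by (simp add: ln_div)
  then have 1: "q * (ln a - ln q) < a - q"
    using assms by (simp add: right_diff_distrib)
  have 2: "(1 - q) * (ln (1 - a) - ln (1 - q)) \<le> q - a"
  proof (cases "q = 1")
    case False
    then have "ln ((1 - a) / (1 - q)) \<le> (1 - a) / (1 - q) - 1"
      using assms by (intro ln_le_minus_one) auto
    then have "(1 - q) * (ln (1 - a) - ln (1 - q)) \<le> (1 - q) * ((1 - a) / (1 - q) - 1)"
      using assms False by (intro mult_left_mono) (auto simp: ln_div)
    also have "\<dots> = q - a"
      using False by (simp add: field_simps)
    finally show ?thesis .
  qed (use assms in simp)
  from 1 2 show ?thesis by (simp add: algebra_simps)
qed

text \<open>The positive part lives on \<open>A\<close> and the negative part on its complement. The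
  second value is written \<open>- c\<close> so that \<open>c = \<infinity>\<close>, total ruin, is
  covered; then \<open>\<infinity> * 0 = 0\<close> settles the case
  \<open>prob A = 1\<close>.\<close>

lemma (in prob_space) eexpectation_two_valued:
  fixes a c :: ereal
  assumes A: "A \<in> events" and nonneg: "0 \<le> a" "0 \<le> c"
    and f: "AE \<omega> in M. f \<omega> = (if \<omega> \<in> A then a else - c)"
  shows "eexpectation M f = a * ereal (prob A) - c * ereal (1 - prob A)"
proof -
  have neg: "e2ennreal (- x) = 0" if "0 \<le> x" for x :: ereal
    using that by (simp add: e2ennreal_neg)
  have "(\<integral>\<^sup>+ \<omega>. e2ennreal (f \<omega>) \<partial>M) = (\<integral>\<^sup>+ \<omega>. e2ennreal a * indicator A \<omega> \<partial>M)"
    using f by (intro nn_integral_cong_AE) (auto simp: neg nonneg elim!: eventually_mono)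
  also have "\<dots> = e2ennreal a * ennreal (prob A)"
    using A by (simp add: nn_integral_cmult_indicator emeasure_eq_measure)
  finally have pos_part: "enn2ereal (\<integral>\<^sup>+ \<omega>. e2ennreal (f \<omega>) \<partial>M) = a * ereal (prob A)"
    using nonneg by (simp add: times_ennreal.rep_eq enn2ereal_e2ennreal)
  have "(\<integral>\<^sup>+ \<omega>. e2ennreal (- f \<omega>) \<partial>M) = (\<integral>\<^sup>+ \<omega>. e2ennreal c * indicator (space M - A) \<omega> \<partial>M)"
    using f AE_space
    by (intro nn_integral_cong_AE, eventually_elim) (auto simp: neg nonneg indicator_def)
  also have "\<dots> = e2ennreal c * ennreal (1 - prob A)"
    using A by (simp add: nn_integral_cmult_indicator emeasure_eq_measure prob_compl)
  finally have neg_part: "enn2ereal (\<integral>\<^sup>+ \<omega>. e2ennreal (- f \<omega>) \<partial>M) = c * ereal (1 - prob A)"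
    using nonneg by (simp add: times_ennreal.rep_eq enn2ereal_e2ennreal)
  show ?thesis
    by (simp add: eexpectation_def pos_part neg_part)
qed

lemma (in prob_space) prob_all_wins:
  fixes X :: "nat \<Rightarrow> 'a \<Rightarrow> real"
  assumes "indep_vars (\<lambda>_. borel) X UNIV" "\<And>k. prob {\<omega> \<in> space M. X k \<omega> = 1} = p"
  shows "prob {\<omega> \<in> space M. \<forall>k<n. X k \<omega> = 1} = p ^ n"
\<comment> \<open>The product rule for independent variables asks for a nonempty index set, and the
  empty intersection would be \<open>UNIV\<close> instead of \<open>space M\<close>.\<close>
proof (cases "n = 0")
  case False
  have "prob (\<Inter>k\<in>{..<n}. X k -` {1} \<inter> space M) = (\<Prod>k<n. prob (X k -` {1} \<inter> space M))"
    using False by (intro indep_varsD[OF assms(1)]) auto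
  moreover have "(\<Inter>k\<in>{..<n}. X k -` {1} \<inter> space M) = {\<omega> \<in> space M. \<forall>k<n. X k \<omega> = 1}"
    using False by auto
  moreover have "X k -` {1} \<inter> space M = {\<omega> \<in> space M. X k \<omega> = 1}" for k
    by auto
  ultimately show ?thesis
    using assms(2) by simp
qed (simp add: prob_space)

lemma (in prob_space) AE_two_valued:
  fixes Y :: "'a \<Rightarrow> real"
  assumes [measurable]: "random_variable borel Y" and "a \<noteq> b"
    and "prob {\<omega> \<in> space M. Y \<omega> = a} = p" "prob {\<omega> \<in> space M. Y \<omega> = b} = 1 - p"
  shows "AE \<omega> in M. Y \<omega> = a \<or> Y \<omega> = b"
proof -
  have "prob {\<omega> \<in> space M. Y \<omega> = a \<or> Y \<omega> = b}
      = prob ({\<omega> \<in> space M. Y \<omega> = a} \<union> {\<omega> \<in> space M. Y \<omega> = b})"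
    by (rule arg_cong[where f = prob]) auto
  also have "\<dots> = 1"
    using assms by (subst finite_measure_Union) auto
  finally show ?thesis
    by (subst prob_Collect_eq_1[symmetric]) auto
qed

lemma total_return_two_valued:
  assumes "\<And>k. X k \<omega> = 1 \<or> X k \<omega> = -1"
  shows "total_return X n \<omega> = (if \<forall>k<n. X k \<omega> = 1 then 2 ^ n - 1 else -1)"
proof (cases "\<forall>k<n. X k \<omega> = 1")
  case True
  then show ?thesis by (simp add: total_return_def)
next
  case False
  then obtain k where "k < n" "1 + X k \<omega> = 0"
    using assms by fastforce
  then have "(\<Prod>k<n. 1 + X k \<omega>) = 0"
    by (intro prod_zero) auto
  with False show ?thesis by (auto simp: total_return_def)
qed

text \<open>Betting everything with \<open>p ^ n < 1\<close> means ruin with probability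
  \<open>1 - p ^ n > 0\<close>. This case is split off because the real-valued
  \<open>ln 0 = 0\<close> would hide the value \<open>-\<infinity>\<close>.\<close>

lemma (in prob_space) log_growth_coin:
  fixes X :: "nat \<Rightarrow> 'a \<Rightarrow> real"
  assumes indep: "indep_vars (\<lambda>_. borel) X UNIV"
    and p: "\<And>k. prob {\<omega> \<in> space M. X k \<omega> = 1} = p"
      "\<And>k. prob {\<omega> \<in> space M. X k \<omega> = -1} = 1 - p"
    and K: "K \<in> {0..1}" and "n \<ge> 1"
  shows "log_growth M X n K =
    (if K = 1 \<and> p ^ n < 1 then -\<infinity>
     else ereal ((p ^ n * ln (1 + K * (2 ^ n - 1)) + (1 - p ^ n) * ln (1 - K)) / n))"
proof -
  define A where "A = {\<omega> \<in> space M. \<forall>k<n. X k \<omega> = 1}"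
  have [measurable]: "random_variable borel (X k)" for k
    using indep by (auto simp: indep_vars_def)
  have A [measurable]: "A \<in> events"
    unfolding A_def by measurable
  have prob_A: "prob A = p ^ n"
    unfolding A_def using indep p(1) by (rule prob_all_wins)
  have "p ^ n \<le> 1"
    using prob_A prob_le_1[of A] by simp
  have win: "1 \<le> 1 + K * (2 ^ n - 1)"
    using K by simp
  have "AE \<omega> in M. \<forall>k. X k \<omega> = 1 \<or> X k \<omega> = -1"
    using p by (subst AE_all_countable) (auto intro!: AE_two_valued[where p = p])
  \<comment> \<open>The double negation exhibits the losing value as \<open>- c\<close> with
    \<open>c = - elog (1 - K) \<ge> 0\<close>; the winning value is nonnegative by
    \<open>win\<close>.\<close>
  then have "AE \<omega> in M. elog (1 + K * total_return X n \<omega>)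
      = (if \<omega> \<in> A then ereal (ln (1 + K * (2 ^ n - 1))) else - (- elog (1 - K)))"
    using AE_space
    by eventually_elim (use win in \<open>auto simp: total_return_two_valued A_def elog_def\<close>)
  moreover have "0 \<le> - elog (1 - K)"
    using K by (auto simp: elog_def)
  ultimately have E: "eexpectation M (\<lambda>\<omega>. elog (1 + K * total_return X n \<omega>))
      = ereal (ln (1 + K * (2 ^ n - 1))) * ereal (p ^ n) - (- elog (1 - K)) * ereal (1 - p ^ n)"
    using win unfolding prob_A[symmetric] by (intro eexpectation_two_valued A) auto
  show ?thesis
  proof (cases "K = 1")
    case True
    then show ?thesis
      using E \<open>p ^ n \<le> 1\<close> \<open>n \<ge> 1\<close>
      by (cases "p ^ n = 1") (auto simp: log_growth_def elog_def)
  next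
    case False
    then show ?thesis
      using E K by (simp add: log_growth_def elog_def field_simps diff_divide_distrib)
  qed
qed

theorem theorem1:
  fixes M :: "'a measure" and X :: "nat \<Rightarrow> 'a \<Rightarrow> real" and p :: real and n :: nat
  assumes "prob_space M"
    and "1 / 2 < p" and "p \<le> 1"
    and "prob_space.indep_vars M (\<lambda>_. borel) X UNIV"
    and "\<And>k. measure M {\<omega> \<in> space M. X k \<omega> = 1} = p"
    and "\<And>k. measure M {\<omega> \<in> space M. X k \<omega> = -1} = 1 - p"
    and "n \<ge> 1"
  shows "(\<forall>K. opt_kelly_fraction M X n K \<longleftrightarrow> K = (2 ^ n * p ^ n - 1) / (2 ^ n - 1))
    \<and> opt_log_growth M X n =
        ereal (p ^ n) * elog p
        + ereal ((1 - p ^ n) / real n) * elog ((1 - p ^ n) / (2 ^ n - 1))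
        + elog 2"
proof -
  interpret prob_space M by fact
  define q where "q = p ^ n"
  define N :: real where "N = 2 ^ n"
  define L where "L = (2 ^ n * p ^ n - 1) / (2 ^ n - 1 :: real)"
  define h where "h = (\<lambda>K. q * ln (1 + K * (N - 1)) + (1 - q) * ln (1 - K))"
  \<comment> \<open>What remains after writing \<open>1 + K * (N - 1) = N * a\<close> and
    \<open>1 - K = (1 - a) * N / (N - 1)\<close> inside the logarithms of \<open>h\<close>.\<close>
  define C where "C = q * ln N + (1 - q) * (ln N - ln (N - 1))"
  have N: "N > 1"
    unfolding N_def using \<open>n \<ge> 1\<close> by (intro one_less_power) auto
  have q: "0 < q" "q \<le> 1"
    using assms(2,3) by (auto simp: q_def power_le_one)
  \<comment> \<open>Since \<open>N * q = (2 * p) ^ n\<close>, the favourable coin is what makes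
    \<open>L\<close> nonnegative.\<close>
  have Nq: "1 \<le> N * q"
    using assms(2) one_le_power[of "2 * p" n] by (simp add: q_def N_def power_mult_distrib)
  have L_eq: "L = (N * q - 1) / (N - 1)"
    by (simp add: L_def N_def q_def)
  have L: "L \<in> {0..1}"
    using N q Nq by (simp add: L_eq)
  have growth: "log_growth M X n K = (if K = 1 \<and> q < 1 then -\<infinity> else ereal (h K / n))"
    if "K \<in> {0..1}" for K
    using log_growth_coin[OF assms(4-6) that \<open>n \<ge> 1\<close>] by (simp add: q_def N_def h_def)
  have h_eq: "h K = q * ln a + (1 - q) * ln (1 - a) + C"
    if "K \<in> {0..1}" "q = 1 \<or> K < 1" and a: "a = (1 + K * (N - 1)) / N" for K a
  proof -
    have "0 < 1 + K * (N - 1)"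
      using that N by (simp add: add_pos_nonneg)
    then have ln_a: "ln a = ln (1 + K * (N - 1)) - ln N"
      using N by (simp add: a ln_div)
    have "1 - a = (1 - K) * (N - 1) / N"
      using N by (simp add: a field_simps)
    then have "(1 - q) * ln (1 - a) = (1 - q) * (ln (1 - K) + ln (N - 1) - ln N)"
      using that N by (auto simp: ln_div ln_mult)
    with ln_a show ?thesis
      by (simp add: h_def C_def right_diff_distrib distrib_left)
  qed
  \<comment> \<open>\<open>L\<close> solves \<open>a = q\<close>, the equality case of the Gibbs
    inequality.\<close>
  have at_L: "q = (1 + L * (N - 1)) / N"
    using N by (simp add: L_eq)
  have L_less: "q = 1 \<or> L < 1"
    using N q by (auto simp: L_eq)
  have growth_L: "log_growth M X n L = ereal ((q * ln q + (1 - q) * ln (1 - q) + C) / n)"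
    using growth[OF L] h_eq[OF L L_less at_L] L_less by auto
  \<comment> \<open>Strictness yields optimality of \<open>L\<close> and its uniqueness
    together.\<close>
  have less: "log_growth M X n K < log_growth M X n L" if K: "K \<in> {0..1}" "K \<noteq> L" for K
  proof (cases "q = 1 \<or> K < 1")
    case True
    define a where "a = (1 + K * (N - 1)) / N"
    have "0 < a"
      using K N by (simp add: a_def add_pos_nonneg)
    moreover have "1 - a = (1 - K) * (N - 1) / N"
      using N by (simp add: a_def field_simps)
    then have "a \<le> 1" "q = 1 \<or> a < 1"
      using K N True by (smt (verit) atLeastAtMost_iff divide_pos_pos divide_nonneg_pos
          mult_pos_pos mult_nonneg_nonneg)+
    moreover have "a \<noteq> q"
      using K N by (simp add: a_def at_L)
    ultimately have "q * ln a + (1 - q) * ln (1 - a) < q * ln q + (1 - q) * ln (1 - q)"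
      using q by (intro binary_gibbs_strict)
    then show ?thesis
      using growth[OF K(1)] h_eq[OF K(1) True a_def] growth_L True \<open>n \<ge> 1\<close>
      by (auto simp: divide_strict_right_mono)
  next
    \<comment> \<open>Here \<open>K = 1\<close> and \<open>q < 1\<close>, so the growth is
      \<open>-\<infinity>\<close>, while at \<open>L\<close> it is finite.\<close>
    case False
    then show ?thesis
      using growth[OF K(1)] growth_L K q by auto
  qed
  have opt: "opt_log_growth M X n = log_growth M X n L"
    unfolding opt_log_growth_def
    using L less by (intro antisym SUP_least SUP_upper) (metis order_less_imp_le order_refl)+
  have "opt_kelly_fraction M X n K \<longleftrightarrow> K = L" for K
    unfolding opt_kelly_fraction_def opt using L less by fastforce
  moreover have "log_growth M X n L =
      ereal q * elog p + ereal ((1 - q) / real n) * elog ((1 - q) / (N - 1)) + elog 2"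
  proof -
    have "ln q = n * ln p" "ln N = n * ln 2"
      using assms(2) by (simp_all add: q_def N_def ln_realpow)
    then have "(q * ln q + (1 - q) * ln (1 - q) + C) / n
        = q * ln p + (1 - q) / n * (ln (1 - q) - ln (N - 1)) + ln 2"
      using \<open>n \<ge> 1\<close> by (simp add: C_def field_simps)
    \<comment> \<open>For \<open>q = 1\<close> the middle term is \<open>0 * -\<infinity>\<close>,
      which is 0 in \<open>ereal\<close>, as the convention demands.\<close>
    then show ?thesis
      unfolding growth_L using N q assms(2)
      by (cases "q = 1") (auto simp: elog_def ln_div)
  qed
  ultimately show ?thesis
    unfolding opt L_def q_def N_def by blast
qed

end
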